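(* Let $\varepsilon>0$ be a fixed constant and $\delta=n^{-(1/3+\varepsilon)}$. Let $N=O(\log n)$ (with a suitably large constant). Given $N$ traces drawn independently from $\mathrm{Del}_\delta(x)$ for some unknown string $x\in\{0,1\}^n$, the algorithm BMA (run with length parameter $n$ on these traces) runs in $\tilde O(n)$ time and returns a string $w\in\{0,1\}^n$ such that: (1) if $x$ has no desert, then $w=x$ with probability at least $1-1/n^2$; (2) if $x$ has at least one desert, then $w$ and $x$ share the same $(r+m+1)$-bit prefix with probability at least $1-1/n^2$, where $r$ is the first location that is deep in a desert of $x$.
   Context: Strings are indexed from $0$: $x=(x_0,\dots,x_{n-1})$, and $x_{[a:b]}=(x_a,\dots,x_b)$. For $0<\delta<1$, $\mathrm{Del}_\delta(x)$ is the distribution of the string obtained from $x$ by deleting each bit independently with probability $\delta$ and concatenating the survivors (a trace of $x$). Let $C=\lceil 100/\varepsilon\rceil$, $m=n^{1/3}$, $M=2m+1$. For $s\in\{0,1\}^{\le C}$, a string $z$ is an $s$-desert if $z$ is a prefix of the infinite string $sss\cdots$ and $|z|\ge M$; a desert is an $s$-desert for some $s\in\{0,1\}^{\le C}$. A location $i$ of $x$ is deep in a desert if the length-$M$ subword $x_{[i-m:i+m]}$ is a desert; $x$ has no desert if no subword of $x$ is a desert. Algorithm BMA: input a length $n'$ and a multiset $\{z^1,\dots,z^N\}$ of strings of length at most $n'$. Pad each $z^i$ with $0$'s at the end to a string $u^i$ of length $n'$. Set $\mathrm{current}_i(0)=0$ for all $i$. For $t=0,1,\dots,n'-1$: let $w_t$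 be the majority of the bits $u^1_{\mathrm{current}_1(t)},\dots,u^N_{\mathrm{current}_N(t)}$; for each $i$, set $\mathrm{current}_i(t+1)=\mathrm{current}_i(t)+1$ if $u^i_{\mathrm{current}_i(t)}=w_t$ and $\mathrm{current}_i(t+1)=\mathrm{current}_i(t)$ otherwise. Output $w=(w_0,\dots,w_{n'-1})$. *)

theory Defs
  imports "HOL-Probability.Probability" "HOL-Library.Sublist" "HOL-Library.Stream"
    "HOL-Library.Monad_Syntax" "HOL-Library.Landau_Symbols"
begin

section \<open>The deletion channel\<close>

text \<open>
  Strings over $\{0,1\}$ are lists of Booleans, with 1 represented by \<^const>\<open>True\<close>.
  In \<open>Del\<close>, the random function \<open>D\<close> consists of independent coins; \<open>D i\<close> says that the bit
  at position \<open>i\<close> is deleted. \<^const>\<open>nths\<close> concatenates the bits at the surviving positions.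
\<close>

definition Del :: "real \<Rightarrow> bool list \<Rightarrow> bool list pmf" where
  "Del \<delta> x =
     map_pmf (\<lambda>D. nths x {i. \<not> D i}) (Pi_pmf {..<length x} False (\<lambda>_. bernoulli_pmf \<delta>))"


section \<open>Deserts\<close>

text \<open>
  The paper's parameters as functions of \<open>\<epsilon>\<close> and \<open>n\<close>. Since \<open>m\<close> is used as a length, $n^{1/3}$
  is rounded down (which is exact if \<open>n\<close> is a cube).
\<close>

definition C_par :: "real \<Rightarrow> nat" where
  "C_par \<epsilon> = nat \<lceil>100 / \<epsilon>\<rceil>"

definition m_par :: "nat \<Rightarrow> nat" where
  "m_par n = nat \<lfloor>root 3 (real n)\<rfloor>"

definition M_par :: "nat \<Rightarrow> nat" where
  "M_par n = 2 * m_par n + 1"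

text \<open>
  The stream \<open>cycle s\<close> is the infinite string $sss\cdots$; it is meaningful only for nonempty \<open>s\<close>.
\<close>

definition s_desert :: "nat \<Rightarrow> bool list \<Rightarrow> bool list \<Rightarrow> bool" where
  "s_desert n s z \<longleftrightarrow> s \<noteq> [] \<and> z = stake (length z) (cycle s) \<and> M_par n \<le> length z"

definition desert :: "real \<Rightarrow> nat \<Rightarrow> bool list \<Rightarrow> bool" where
  "desert \<epsilon> n z \<longleftrightarrow> (\<exists>s. length s \<le> C_par \<epsilon> \<and> s_desert n s z)"

text \<open>\<open>subword x a b\<close> is $x_{[a:b]} = (x_a,\dots,x_b)$, with both end points included.\<close>

definition subword :: "'a list \<Rightarrow> nat \<Rightarrow> nat \<Rightarrow> 'a list" where
  "subword x a b = take (b + 1 - a) (drop a x)"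

definition deep_in_desert :: "real \<Rightarrow> nat \<Rightarrow> bool list \<Rightarrow> nat \<Rightarrow> bool" where
  "deep_in_desert \<epsilon> n x i \<longleftrightarrow>
     m_par n \<le> i \<and> i + m_par n < length x \<and>
     desert \<epsilon> n (subword x (i - m_par n) (i + m_par n))"

text \<open>\<^const>\<open>sublist\<close> is the contiguous subword relation.\<close>

definition has_desert :: "real \<Rightarrow> nat \<Rightarrow> bool list \<Rightarrow> bool" where
  "has_desert \<epsilon> n x \<longleftrightarrow> (\<exists>z. sublist z x \<and> desert \<epsilon> n z)"

definition first_deep :: "real \<Rightarrow> nat \<Rightarrow> bool list \<Rightarrow> nat" where
  "first_deep \<epsilon> n x = (LEAST i. deep_in_desert \<epsilon> n x i)"


section \<open>Bitwise majority alignment\<close>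

text \<open>
  The multiset of input strings is given as a list; the order of the list does not affect the
  output. Ties in a majority vote are resolved to the bit 0.
\<close>

definition pad :: "nat \<Rightarrow> bool list \<Rightarrow> bool list" where
  "pad n z = z @ replicate (n - length z) False"

definition majority :: "bool list \<Rightarrow> bool" where
  "majority bs \<longleftrightarrow> length bs < 2 * count_list bs True"

text \<open>
  \<open>currents us t\<close> is the list of the pointers $\mathrm{current}_1(t),\dots,\mathrm{current}_N(t)$
  for the padded strings \<open>us\<close>, and \<open>vote us c\<close> is the majority bit for the pointers \<open>c\<close>.
\<close>

definition vote :: "bool list list \<Rightarrow> nat list \<Rightarrow> bool" where
  "vote us c = majority (map2 (!) us c)"

primrec currents :: "bool list list \<Rightarrow> nat \<Rightarrow> nat list" where
  "currents us 0 = map (\<lambda>_. 0) us"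
| "currents us (Suc t) =
     (let c = currents us t
      in map2 (\<lambda>u j. if u ! j = vote us c then j + 1 else j) us c)"

definition BMA :: "nat \<Rightarrow> bool list list \<Rightarrow> bool list" where
  "BMA n zs = (let us = map (pad n) zs in map (\<lambda>t. vote us (currents us t)) [0..<n])"


section \<open>Running time\<close>

text \<open>
  Running time is the number of steps on a unit-cost RAM, recorded by a step-counting monad.
  Reading or writing an array cell, a constant number of operations on machine words (including
  asking for the length of an array), and the control of a loop for one iteration cost one step
  each; allocating an array costs one step more than its length. Lists stand for arrays, and \<open>write\<close> for
  an update in place: no program below uses an array again after it has been overwritten.
  All numbers handled by the program are at most \<open>max n (2 * N)\<close> for \<open>N\<close> input strings of length
  at most \<open>n\<close>, so for \<open>N\<close> logarithmic in \<open>n\<close> charging for bit operations instead would change the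
  running time by a polylogarithmic factor only.
\<close>

datatype 'a timed = Timed (val: 'a) (time: nat)

definition bind_timed :: "'a timed \<Rightarrow> ('a \<Rightarrow> 'b timed) \<Rightarrow> 'b timed" where
  "bind_timed a f = Timed (val (f (val a))) (time a + time (f (val a)))"

adhoc_overloading Monad_Syntax.bind \<rightleftharpoons> bind_timed

definition return_timed :: "'a \<Rightarrow> 'a timed" where
  "return_timed v = Timed v 0"

definition cpu :: "'a \<Rightarrow> 'a timed" where
  "cpu v = Timed v 1"

definition read :: "'a list \<Rightarrow> nat \<Rightarrow> 'a timed" where
  "read xs i = Timed (xs ! i) 1"

definition "write" :: "'a list \<Rightarrow> nat \<Rightarrow> 'a \<Rightarrow> 'a list timed" where
  "write xs i v = Timed (xs[i := v]) 1"

definition alloc :: "nat \<Rightarrow> 'a \<Rightarrow> 'a list timed" where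
  "alloc k v = Timed (replicate k v) (k + 1)"

primrec loop :: "nat \<Rightarrow> (nat \<Rightarrow> 's \<Rightarrow> 's timed) \<Rightarrow> 's \<Rightarrow> 's timed" where
  "loop 0 f s = return_timed s"
| "loop (Suc k) f s = do { s' \<leftarrow> loop k f s; cpu (); f k s' }"

definition pad_timed :: "nat \<Rightarrow> bool list \<Rightarrow> bool list timed" where
  "pad_timed n z = do {
     u \<leftarrow> alloc n False;
     l \<leftarrow> cpu (length z);
     loop n (\<lambda>j u. do {
       inside \<leftarrow> cpu (j < l);
       if inside then do { b \<leftarrow> read z j; write u j b } else return_timed u
     }) u
   }"

definition count_timed :: "bool list list \<Rightarrow> nat list \<Rightarrow> nat timed" where
  "count_timed us cur = do {
     k \<leftarrow> cpu (length us);
     loop k (\<lambda>i ones. do {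
       u \<leftarrow> read us i;
       j \<leftarrow> read cur i;
       b \<leftarrow> read u j;
       if b then cpu (ones + 1) else return_timed ones
     }) 0
   }"

definition advance_timed :: "bool list list \<Rightarrow> bool \<Rightarrow> nat list \<Rightarrow> nat list timed" where
  "advance_timed us w cur = do {
     k \<leftarrow> cpu (length us);
     loop k (\<lambda>i cur. do {
       u \<leftarrow> read us i;
       j \<leftarrow> read cur i;
       b \<leftarrow> read u j;
       agree \<leftarrow> cpu (b = w);
       if agree then write cur i (j + 1) else return_timed cur
     }) cur
   }"

definition BMA_timed :: "nat \<Rightarrow> bool list list \<Rightarrow> bool list timed" where
  "BMA_timed n zs = do {
     k \<leftarrow> cpu (length zs);
     us0 \<leftarrow> alloc k [];
     us \<leftarrow> loop k (\<lambda>i us. do { z \<leftarrow> read zs i; u \<leftarrow> pad_timed n z; write us i u }) us0;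
     cur0 \<leftarrow> alloc k 0;
     out0 \<leftarrow> alloc n False;
     (cur, out) \<leftarrow> loop n (\<lambda>t (cur, out). do {
       ones \<leftarrow> count_timed us cur;
       w \<leftarrow> cpu (k < 2 * ones);
       out' \<leftarrow> write out t w;
       cur' \<leftarrow> advance_timed us w cur;
       return_timed (cur', out')
     }) (cur0, out0);
     return_timed out
   }"

end

theory Submission
  imports Defs "HOL-Real_Asymp.Real_Asymp"
begin

text \<open>
  As long as all votes so far were right, the pointer of a single trace runs ahead of the true
  position by the number of deletions passed minus the number of mismatches between its bit
  and the vote. If this lead \<open>d\<close> satisfies \<open>0 < d \<le> C\<close>, then \<open>M\<close> steps without a mismatch and without
  a deletion would make the string \<open>d\<close>-periodic on a window of length \<open>M\<close>, which is excluded
  outside deserts. So if every window of length $O(CM)$ contains at most \<open>C\<close> deletions, the lead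
  returns to 0 within $2CM$ steps, and it can be positive at time \<open>t\<close> only if there is a
  deletion in the $O(CM)$ positions before \<open>t\<close>. Since $M\delta = O(n^{-\varepsilon})$, a deletion there has
  probability $O(n^{-\varepsilon})$, and some window with more than \<open>C\<close> deletions has probability
  $O(n \cdot n^{-\varepsilon(C+1)})$, which is small as $\varepsilon C \ge 100$. Each trace thus votes
  wrongly at time \<open>t\<close> with probability $o(1)$, and the majority of logarithmically many independent
  traces is right at all times with probability at least $1 - 1/n^2$.
\<close>


section \<open>Greedy alignment of a single trace\<close>

text \<open>
  The pointer into the padded trace \<open>u\<close> when the votes so far have spelled out a prefix of \<open>X\<close>.
  Unlike the pointer in the algorithm it depends on a single trace only, so the pointers of
  different traces are independent.
\<close>

primrec pointer :: "(nat \<Rightarrow> bool) \<Rightarrow> (nat \<Rightarrow> bool) \<Rightarrow> nat \<Rightarrow> nat" where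
  "pointer X u 0 = 0"
| "pointer X u (Suc t) =
     (if u (pointer X u t) = X t then Suc (pointer X u t) else pointer X u t)"

lemma pointer_le: "pointer X u t \<le> t"
  by (induction t) auto

text \<open>A pointer moves at most one cell per step, so up to time \<open>n\<close> only the first
  \<open>n\<close> cells matter. Used to replace the padded trace by an infinite one.\<close>

lemma pointer_cong:
  assumes "\<And>j. j < n \<Longrightarrow> u j = u' j" "\<And>j. j < n \<Longrightarrow> X j = X' j" "t \<le> n"
  shows "pointer X u t = pointer X' u' t"
  using assms(3)
proof (induction t)
  case (Suc t)
  moreover have "pointer X' u' t < n"
    using pointer_le[of X' u' t] Suc.prems by simp
  ultimately show ?case
    using assms(1,2) by simp
qed simp

lemma card_less_enumerate:
  fixes S :: "nat set"
  assumes "infinite S"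
  shows "card ({..<enumerate S j} \<inter> S) = j"
proof -
  have "{..<enumerate S j} \<inter> S = enumerate S ` {..<j}"
  proof (intro equalityI subsetI)
    fix s assume "s \<in> {..<enumerate S j} \<inter> S"
    moreover from this obtain i where "enumerate S i = s"
      using enumerate_Ex[of S s] assms by auto
    ultimately show "s \<in> enumerate S ` {..<j}"
      using assms by auto
  next
    fix s assume "s \<in> enumerate S ` {..<j}"
    then show "s \<in> {..<enumerate S j} \<inter> S"
      using assms enumerate_in_set[of S] by auto
  qed
  then show ?thesis
    using inj_enumerate[OF assms] by (simp add: card_image inj_on_subset)
qed

text \<open>
  Since traces are padded with zeros, the string is extended by infinitely many undeleted zeros;
  the trace is then the enumeration of the surviving positions \<open>- D\<close>. The bit under the pointer
  at time \<open>t\<close> comes from position \<open>front t\<close>, and the vote is right as soon as \<open>front t = t\<close>.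
\<close>

locale alignment =
  fixes X :: "nat \<Rightarrow> bool" and D :: "nat set"
  assumes finite_D: "finite D"
begin

definition cur :: "nat \<Rightarrow> nat" where
  "cur = pointer X (\<lambda>j. X (enumerate (- D) j))"

definition front :: "nat \<Rightarrow> nat" where
  "front t = enumerate (- D) (cur t)"

lemma infinite_Compl_D: "infinite (- D)"
  using finite_D by simp

lemma front_notin: "front t \<notin> D"
  using enumerate_in_set[OF infinite_Compl_D] by (auto simp: front_def)

lemma card_survivors_front: "card ({..<front t} - D) = cur t"
  using card_less_enumerate[OF infinite_Compl_D, of "cur t"]
  by (simp add: front_def Diff_eq)

lemma cur_0: "cur 0 = 0"
  by (simp add: cur_def)

lemma cur_Suc: "cur (Suc t) = (if X (front t) = X t then Suc (cur t) else cur t)"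
  by (simp add: cur_def front_def)

lemma cur_le: "cur t \<le> t"
  by (simp add: cur_def pointer_le)

lemma cur_add: "cur t \<le> cur (t + k)" "cur (t + k) \<le> cur t + k"
  by (induction k) (auto simp: cur_Suc)

lemma front_Suc_less: "cur (Suc t) = Suc (cur t) \<Longrightarrow> front t < front (Suc t)"
  using infinite_Compl_D by (simp add: front_def)

text \<open>A pointer exactly at position \<open>t\<close> compares \<open>X t\<close> with itself
  and must advance, so it never falls behind.\<close>

lemma le_front: "t \<le> front t"
proof (induction t)
  case (Suc t)
  show ?case
  proof (cases "front t = t")
    case True
    then have "cur (Suc t) = Suc (cur t)"
      by (simp add: cur_Suc)
    with front_Suc_less[of t] True show ?thesis
      by simp
  next
    case False
    have "front t \<le> front (Suc t)"
      using infinite_Compl_D by (simp add: front_def cur_Suc)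
    with Suc False show ?thesis
      by simp
  qed
qed simp

lemma card_split:
  assumes "a \<le> b"
  shows "card (A \<inter> {..<b}) = card (A \<inter> {..<a}) + card (A \<inter> {a..<b::nat})"
proof -
  have "A \<inter> {..<b} = (A \<inter> {..<a}) \<union> (A \<inter> {a..<b})"
    using assms by auto
  then show ?thesis
    by (simp add: card_Un_disjoint Int_Un_distrib disjoint_iff)
qed

lemma card_survivors: "card ({..<t} - D) + card (D \<inter> {..<t}) = t"
proof -
  have "card (({..<t} - D) \<union> (D \<inter> {..<t})) = card ({..<t} - D) + card (D \<inter> {..<t})"
    by (rule card_Un_disjoint) auto
  moreover have "({..<t} - D) \<union> (D \<inter> {..<t}) = {..<t}"
    by auto
  ultimately show ?thesis
    by simp
qed

lemma front_eq: "front t = cur t + card (D \<inter> {..<front t})"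
  using card_survivors[of "front t"] card_survivors_front[of t] by simp

text \<open>The survivors before \<open>t\<close> are exactly those consumed, so the pointer is at
  the first survivor from \<open>t\<close> on. This is weaker than \<open>front t = t\<close>, as
  \<open>t\<close> may be deleted.\<close>

definition aligned :: "nat \<Rightarrow> bool" where
  "aligned t \<longleftrightarrow> cur t = card ({..<t} - D)"

lemma aligned_0: "aligned 0"
  by (simp add: aligned_def cur_0)

lemma aligned_eq: "aligned t \<Longrightarrow> t = cur t + card (D \<inter> {..<t})"
  using card_survivors[of t] by (simp add: aligned_def)

lemma aligned_front_eq:
  assumes "aligned t" "t \<notin> D"
  shows "front t = t"
proof (rule ccontr)
  assume "front t \<noteq> t"
  with le_front[of t] have "t < front t"
    by simp
  then have "{..<t} - D \<subset> {..<front t} - D"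
    using assms(2) by auto
  then have "card ({..<t} - D) < card ({..<front t} - D)"
    by (intro psubset_card_mono) auto
  then show False
    using assms(1) by (simp add: aligned_def card_survivors_front)
qed

lemma aligned_Suc:
  assumes "front t = t"
  shows "aligned (Suc t)"
proof -
  have "{..<Suc t} - D = insert t ({..<t} - D)"
    using front_notin[of t] assms by auto
  then show ?thesis
    using card_survivors_front[of t] assms by (simp add: aligned_def cur_Suc)
qed

text \<open>The deletions passed since \<open>t0\<close> number the current lead plus the mismatches
  since \<open>t0\<close>; the additive form avoids truncated subtraction.\<close>

lemma deletions_passed_eq:
  assumes "aligned t0"
  shows "front (t0 + k) + cur t0 = cur (t0 + k) + t0 + card (D \<inter> {t0..<front (t0 + k)})"
proof -
  have "t0 \<le> front (t0 + k)"
    using le_front[of "t0 + k"] by simp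
  from card_split[OF this, of D] show ?thesis
    using front_eq[of "t0 + k"] aligned_eq[OF assms] by simp
qed

text \<open>The window has at least \<open>W - C > k\<close> survivors, and \<open>k\<close> steps
  consume at most \<open>k\<close> of them; so the front stays inside the window.\<close>

lemma deletions_passed_le:
  assumes "aligned t0" "card (D \<inter> {t0..<t0 + W}) \<le> C" "k + C < W"
  shows "card (D \<inter> {t0..<front (t0 + k)}) \<le> C"
proof -
  have "front (t0 + k) < t0 + W"
  proof (rule ccontr)
    assume "\<not> front (t0 + k) < t0 + W"
    then have "card ({..<t0 + W} - D) \<le> card ({..<front (t0 + k)} - D)"
      by (intro card_mono) auto
    then have "card ({..<t0 + W} - D) \<le> cur t0 + k"
      using cur_add(2)[of t0 k] by (simp add: card_survivors_front)
    then show False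
      using card_survivors[of "t0 + W"] aligned_eq[OF assms(1)] assms(2,3)
        card_split[of t0 "t0 + W" D]
      by simp
  qed
  then have "card (D \<inter> {t0..<front (t0 + k)}) \<le> card (D \<inter> {t0..<t0 + W})"
    by (intro card_mono) auto
  with assms(2) show ?thesis
    by simp
qed

text \<open>
  The number of mismatches plus the number of deletions passed up to time \<open>t\<close>. At an unaligned
  time it grows during the next \<open>M\<close> steps, since otherwise the string would be periodic there.
\<close>

definition progress :: "nat \<Rightarrow> nat" where
  "progress t = (t - cur t) + (front t - cur t)"

lemma
  shows mismatches_mono: "t - cur t \<le> (t + k) - cur (t + k)"
    and passed_mono: "front t - cur t \<le> front (t + k) - cur (t + k)"
proof -
  show "t - cur t \<le> (t + k) - cur (t + k)"
    using cur_add[of t k] by simp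
  have "front t \<le> front (t + k)"
    using infinite_Compl_D cur_add(1)[of t k] by (simp add: front_def)
  then have "card (D \<inter> {..<front t}) \<le> card (D \<inter> {..<front (t + k)})"
    by (intro card_mono) auto
  then show "front t - cur t \<le> front (t + k) - cur (t + k)"
    using front_eq[of t] front_eq[of "t + k"] by linarith
qed

text \<open>Both summands of \<open>progress\<close> are monotone. If neither grows, the pointer
  advances at every step with constant lead \<open>d\<close>, and the match at time
  \<open>t + j\<close> contradicts the assumed inequality.\<close>

lemma progress_step:
  assumes "front t = t + d" "j + d < M" "X (t + j) \<noteq> X (t + j + d)"
  shows "progress t < progress (t + M)"
proof (rule ccontr)
  assume stalled: "\<not> progress t < progress (t + M)"
  have const: "cur (t + k) = cur t + k \<and> front (t + k) = front t + k" if "k \<le> M" for k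
  proof -
    have le: "t - cur t \<le> (t + k) - cur (t + k)" "front t - cur t \<le> front (t + k) - cur (t + k)"
      using mismatches_mono passed_mono by blast+
    have "(t + k) - cur (t + k) \<le> (t + M) - cur (t + M)"
      "front (t + k) - cur (t + k) \<le> front (t + M) - cur (t + M)"
      using mismatches_mono[of "t + k" "M - k"] passed_mono[of "t + k" "M - k"] that by simp_all
    with stalled le have "t - cur t = (t + k) - cur (t + k)"
      "front t - cur t = front (t + k) - cur (t + k)"
      unfolding progress_def by linarith+
    then show ?thesis
      using cur_le[of t] cur_le[of "t + k"] le_front[of t] le_front[of "t + k"] by linarith
  qed
  from const[of j] const[of "Suc j"] assms(2) have "X (front (t + j)) = X (t + j)"
    using cur_Suc[of "t + j"] by (auto split: if_splits)
  with const[of j] assms show False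
    by (simp add: add_ac)
qed

text \<open>One \<open>C\<close> bounds both the excluded periods and the deletions per window, as
  the lead is at most the number of deletions passed since an alignment.\<close>

context
  fixes a C M W :: nat
  assumes aperiodic: "\<And>s d. s < a \<Longrightarrow> 0 < d \<Longrightarrow> d \<le> C \<Longrightarrow>
      \<exists>j. j + d < M \<and> X (s + j) \<noteq> X (s + j + d)"
    and sparse: "\<And>s. card (D \<inter> {s..<s + W}) \<le> C"
    and window: "(2 * C + 1) * M + C < W"
begin

text \<open>
  Mismatches never outnumber the passed deletions, so \<open>C\<close> deletions allow for at most \<open>2 * C\<close>
  blocks of length \<open>M\<close> before the alignment is restored.
\<close>

lemma realign:
  assumes "aligned t0" "t0 + 2 * C * M < a"
  shows "\<exists>t1 \<ge> t0. t1 \<le> t0 + 2 * C * M \<and> front t1 = t1"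
proof (rule ccontr)
  assume neg: "\<not> ?thesis"
  have passed: "card (D \<inter> {t0..<front (t0 + i * M)}) \<le> C" if "i \<le> 2 * C + 1" for i
  proof (rule deletions_passed_le[OF assms(1) sparse])
    have "i * M \<le> (2 * C + 1) * M"
      using that by (rule mult_le_mono1)
    with window show "i * M + C < W"
      by linarith
  qed
  have "progress t0 + i \<le> progress (t0 + i * M)" if "i \<le> 2 * C + 1" for i
    using that
  proof (induction i)
    case (Suc i)
    let ?t = "t0 + i * M"
    have "i * M \<le> 2 * C * M"
      using Suc.prems by (intro mult_le_mono1) simp
    then have "?t < a" "front ?t \<noteq> ?t"
      using assms(2) neg by (linarith, auto)
    \<comment> \<open>The lead equals the deletions passed minus the mismatches since
      \<open>t0\<close>, hence is at most \<open>C\<close>.\<close>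
    moreover have "front ?t \<le> ?t + C"
      using deletions_passed_eq[OF assms(1), of "i * M"] passed[of i] Suc.prems
        cur_add(2)[of t0 "i * M"] by linarith
    moreover define d where "d = front ?t - ?t"
    ultimately have d: "?t < a" "0 < d" "d \<le> C" "front ?t = ?t + d"
      using le_front[of ?t] by linarith+
    from aperiodic[OF d(1-3)] d(4) have "progress ?t < progress (?t + M)"
      using progress_step by blast
    then show ?case
      using Suc by (simp add: add_ac)
  qed simp
  \<comment> \<open>Since \<open>t0\<close> at most \<open>C\<close> deletions were passed and, the
    lead being nonnegative, at most \<open>C\<close> mismatches occurred; so progress grew by at
    most \<open>2 * C\<close>.\<close>
  from this[of "2 * C + 1"] show False
    using passed[of "2 * C + 1"] deletions_passed_eq[OF assms(1), of "(2 * C + 1) * M"]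
      le_front[of t0] le_front[of "t0 + (2 * C + 1) * M"] cur_le[of t0]
      cur_le[of "t0 + (2 * C + 1) * M"]
    unfolding progress_def by linarith
qed

text \<open>A witness serves until it is \<open>2 * C * M\<close> steps old; then
  \<open>realign\<close> provides a newer one.\<close>

lemma aligned_recently:
  assumes "t \<le> a"
  shows "\<exists>t0 \<le> t. aligned t0 \<and> t \<le> t0 + 2 * C * M"
  using assms
proof (induction t)
  case 0
  then show ?case
    using aligned_0 by auto
next
  case (Suc t)
  then obtain t0 where t0: "t0 \<le> t" "aligned t0" "t \<le> t0 + 2 * C * M"
    by auto
  show ?case
  proof (cases "t = t0 + 2 * C * M")
    case True
    with Suc.prems realign[OF t0(2)] obtain t1
      where "t0 \<le> t1" "t1 \<le> t0 + 2 * C * M" "front t1 = t1"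
      by auto
    \<comment> \<open>The witness is \<open>Suc t1\<close> because \<open>t1\<close> may be
      \<open>t0\<close>, which is now one step too old.\<close>
    with True show ?thesis
      using aligned_Suc[of t1] by (intro exI[of _ "Suc t1"]) simp
  next
    case False
    with t0 show ?thesis
      by (intro exI[of _ t0]) simp
  qed
qed

text \<open>Without deletions alignment persists. The extra \<open>M\<close> in the window lets
  \<open>t\<close> lie less than \<open>M\<close> beyond \<open>a\<close>, although aperiodicity is
  assumed only before \<open>a\<close>.\<close>

lemma front_eq_self:
  assumes "t < a + M" "D \<inter> {t - (2 * C + 1) * M..t} = {}"
  shows "front t = t"
proof -
  obtain t0 where t0: "t0 \<le> min t a" "aligned t0" "min t a \<le> t0 + 2 * C * M"
    using aligned_recently[of "min t a"] by auto
  have notin: "s \<notin> D" if "t0 \<le> s" "s \<le> t" for s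
  proof -
    have "t \<le> t0 + (2 * C + 1) * M"
      using t0(3) assms(1) by (simp add: algebra_simps min_def split: if_splits)
    then have "s \<in> {t - (2 * C + 1) * M..t}"
      using that unfolding atLeastAtMost_iff by linarith
    with assms(2) show ?thesis
      by blast
  qed
  have "s \<le> t \<Longrightarrow> aligned s" if "t0 \<le> s" for s
    using that
  proof (induction s rule: dec_induct)
    case (step s)
    then show ?case
      using aligned_front_eq[of s] aligned_Suc[of s] notin[of s] by simp
  qed (use t0 in simp)
  then show ?thesis
    using aligned_front_eq[of t] notin[of t] t0(1) by simp
qed

end

end


section \<open>From traces to the output of the majority alignment\<close>

text \<open>Extension by zeros to an infinite string, matching the zero padding of the
  traces.\<close>

definition bit_at :: "bool list \<Rightarrow> nat \<Rightarrow> bool" where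
  "bit_at x j \<longleftrightarrow> j < length x \<and> x ! j"

lemma nths_nth_card:
  assumes "p < length x" "p \<in> A"
  shows "nths x A ! card ({..<p} \<inter> A) = x ! p" "card ({..<p} \<inter> A) < length (nths x A)"
proof -
  have x: "x = take p x @ [x ! p] @ drop (Suc p) x"
    using assms(1) by (simp add: id_take_nth_drop)
  have "{i. i < p \<and> i \<in> A} = {..<p} \<inter> A"
    by auto
  then have len: "length (nths (take p x) A) = card ({..<p} \<inter> A)"
    using assms(1) by (simp add: length_nths min_def)
  have "nths (take p x @ [x ! p] @ drop (Suc p) x) A =
      nths (take p x) A @ [x ! p] @ nths (drop (Suc p) x) {j. j + Suc p \<in> A}"
    using assms unfolding nths_append by (simp add: min_def)
  then have "nths x A = nths (take p x) A @ [x ! p] @ nths (drop (Suc p) x) {j. j + Suc p \<in> A}"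
    unfolding x[symmetric] .
  then show "nths x A ! card ({..<p} \<inter> A) = x ! p" "card ({..<p} \<inter> A) < length (nths x A)"
    using len by (simp_all add: nth_append)
qed

lemma length_nths_le: "length (nths x A) \<le> length x"
  using card_mono[of "{..<length x}" "{i. i < length x \<and> i \<in> A}"]
  by (auto simp: length_nths)

text \<open>If the \<open>j\<close>-th survivor lies beyond \<open>x\<close>, the trace has at most
  \<open>j\<close> bits and its padding supplies the same 0 as \<open>bit_at\<close>.\<close>

lemma pad_trace_nth:
  assumes "finite D" "j < length x"
  shows "pad (length x) (nths x (- D)) ! j = bit_at x (enumerate (- D) j)"
proof -
  define p where "p = enumerate (- D) j"
  have inf: "infinite (- D)"
    using assms(1) by simp
  then have notin: "p \<in> - D"
    unfolding p_def by (rule enumerate_in_set)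
  have card: "card ({..<p} \<inter> - D) = j"
    using card_less_enumerate[OF inf] by (simp add: p_def)
  have "pad (length x) (nths x (- D)) ! j = bit_at x p"
  proof (cases "p < length x")
    case True
    then show ?thesis
      using nths_nth_card[OF True notin] card by (simp add: pad_def nth_append bit_at_def)
  next
    case False
    have sub: "{i. i < length x \<and> i \<in> - D} \<subseteq> {..<p} \<inter> - D"
      using False by auto
    then have "length (nths x (- D)) \<le> j"
      using card_mono[OF _ sub] card by (simp add: length_nths)
    then show ?thesis
      using False assms(2) length_nths_le[of x "- D"] by (simp add: pad_def nth_append bit_at_def)
  qed
  then show ?thesis
    by (simp add: p_def)
qed

text \<open>Driven by \<open>x\<close> rather than by the votes, the event depends on one trace
  only, hence is independent across independent traces.\<close>

definition misvote :: "bool list \<Rightarrow> nat \<Rightarrow> bool list \<Rightarrow> bool" where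
  "misvote x t z \<longleftrightarrow>
     (let u = pad (length x) z in u ! pointer (bit_at x) ((!) u) t \<noteq> x ! t)"

lemma (in alignment) not_misvote:
  assumes "X = bit_at x" "t < length x" "front t = t"
  shows "\<not> misvote x t (nths x (- D))"
proof -
  let ?u = "pad (length x) (nths x (- D))"
  have "pointer (bit_at x) ((!) ?u) t = cur t"
    unfolding cur_def using assms(1,2) finite_D
    by (intro pointer_cong[of "length x"]) (simp_all add: pad_trace_nth)
  moreover have "cur t < length x"
    using cur_le[of t] assms(2) by simp
  moreover from this have "?u ! cur t = bit_at x (front t)"
    using finite_D unfolding front_def by (intro pad_trace_nth)
  ultimately show ?thesis
    using assms(2,3) by (simp add: misvote_def Let_def bit_at_def)
qed

lemma majority_eq:
  assumes "2 * length (filter (\<lambda>b. b \<noteq> w) bs) < length bs"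
  shows "majority bs = w"
proof -
  have "count_list bs True = length (filter (\<lambda>b. b) bs)"
    by (induction bs) auto
  moreover have "length (filter (\<lambda>b. b) bs) + length (filter (\<lambda>b. \<not> b) bs) = length bs"
    using sum_length_filter_compl[of "\<lambda>b. b" bs] .
  ultimately show ?thesis
    using assms by (cases w) (auto simp: majority_def)
qed

lemma map2_map_right: "map2 f xs (map g xs) = map (\<lambda>x. f x (g x)) xs"
  by (induction xs) auto

lemma length_BMA: "length (BMA n zs) = n"
  by (simp add: BMA_def Let_def)

text \<open>The pointers driven by \<open>x\<close> elect the right bit at each time, and that bit
  moves the actual pointers in the same way; by induction the two coincide.\<close>

lemma BMA_take_eq:
  assumes "L \<le> length x"
    and few: "\<And>t. t < L \<Longrightarrow> 2 * length (filter (misvote x t) zs) < length zs"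
  shows "take L (BMA (length x) zs) = take L x"
proof -
  define us where "us = map (pad (length x)) zs"
  define p where "p t u = pointer (bit_at x) ((!) u) t" for t and u :: "bool list"
  have vote: "vote us (map (p t) us) = x ! t" if "t < L" for t
  proof -
    have "length (filter (\<lambda>b. b \<noteq> x ! t) (map2 (!) us (map (p t) us))) =
        length (filter (misvote x t) zs)"
      unfolding map2_map_right us_def
      by (simp add: filter_map comp_def p_def misvote_def[abs_def] Let_def)
    with few[OF that] show ?thesis
      unfolding vote_def by (intro majority_eq) (simp add: us_def)
  qed
  have currents: "currents us t = map (p t) us" if "t \<le> L" for t
    using that
  proof (induction t)
    case (Suc t)
    have "x ! t = bit_at x t"
      using Suc.prems assms(1) by (simp add: bit_at_def)
    then show ?case
      using Suc vote[of t] by (auto simp: map2_map_right p_def[abs_def] Let_def)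
  qed (simp add: p_def)
  show ?thesis
    using assms(1) currents vote
    by (intro nth_equalityI) (simp_all add: BMA_def us_def[symmetric] Let_def)
qed


section \<open>Aperiodicity away from deserts\<close>

lemma cycle_snth:
  assumes "u \<noteq> []"
  shows "cycle u !! k = u ! (k mod length u)"
proof (induction k rule: less_induct)
  case (less k)
  show ?case
  proof (cases "k < length u")
    case True
    then show ?thesis
      using assms by (subst cycle_decomp[OF assms]) simp
  next
    case False
    then have "cycle u !! k = cycle u !! (k - length u)"
      by (subst cycle_decomp[OF assms]) simp
    moreover have "k - length u < k"
      using False assms by (simp add: length_greater_0_conv[symmetric] del: length_greater_0_conv)
    ultimately show ?thesis
      using less[of "k - length u"] False by (simp add: le_mod_geq)
  qed
qed

lemma periodic_eq_stake_cycle: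
  assumes "0 < d" "d \<le> length z" "\<And>j. j + d < length z \<Longrightarrow> z ! j = z ! (j + d)"
  shows "z = stake (length z) (cycle (take d z))"
proof (rule nth_equalityI)
  fix k assume "k < length z"
  have "k < length z \<Longrightarrow> z ! k = z ! (k mod d)"
  proof (induction k rule: less_induct)
    case (less k)
    show ?case
    proof (cases "k < d")
      case False
      then show ?thesis
        using less.IH[of "k - d"] less.prems assms(1) assms(3)[of "k - d"]
        by (simp add: le_mod_geq)
    qed simp
  qed
  moreover have "cycle (take d z) !! k = z ! (k mod d)"
    using assms(1,2) by (subst cycle_snth) (auto simp: min_def)
  ultimately show "z ! k = stake (length z) (cycle (take d z)) ! k"
    using \<open>k < length z\<close> by simp
qed simp

text \<open>A window with period \<open>d\<close> repeats its first \<open>d\<close> bits and is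
  thus a desert; \<open>C_par \<epsilon> \<le> M_par n\<close> ensures that it has \<open>d\<close>
  bits.\<close>

lemma aperiodic_of_not_desert:
  assumes "\<not> desert \<epsilon> n (subword x s (s + 2 * m_par n))" "s + M_par n \<le> length x"
    and "0 < d" "d \<le> C_par \<epsilon>" "C_par \<epsilon> \<le> M_par n"
  shows "\<exists>j. j + d < M_par n \<and> bit_at x (s + j) \<noteq> bit_at x (s + j + d)"
proof (rule ccontr)
  assume neg: "\<not> ?thesis"
  define z where "z = subword x s (s + 2 * m_par n)"
  have len: "length z = M_par n"
    using assms(2) by (simp add: z_def subword_def M_par_def)
  have nth: "z ! j = x ! (s + j)" if "j < M_par n" for j
    using that assms(2) by (simp add: z_def subword_def M_par_def)
  have "z ! j = z ! (j + d)" if "j + d < length z" for j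
    using neg that assms(2) len by (auto simp: nth bit_at_def add_ac)
  then have "z = stake (length z) (cycle (take d z))"
    using assms(3-5) len by (intro periodic_eq_stake_cycle) auto
  then have "s_desert n (take d z) z"
    using assms(3) len unfolding s_desert_def by (auto simp: M_par_def)
  then have "desert \<epsilon> n z"
    using assms(4) unfolding desert_def by (intro exI[of _ "take d z"]) auto
  with assms(1) show False
    by (simp add: z_def)
qed

lemma sublist_subword: "sublist (subword x a b) x"
  unfolding subword_def by (metis append_take_drop_id sublist_appendI)

text \<open>Reduces deserts of any length to windows of length exactly
  \<open>M_par n\<close>.\<close>

lemma desert_take:
  assumes "desert \<epsilon> n z"
  shows "M_par n \<le> length z" "desert \<epsilon> n (take (M_par n) z)"
proof -
  from assms obtain s where s: "length s \<le> C_par \<epsilon>" "s \<noteq> []"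
    "z = stake (length z) (cycle s)" "M_par n \<le> length z"
    unfolding desert_def s_desert_def by blast
  show "M_par n \<le> length z"
    by fact
  have "take (M_par n) z = stake (M_par n) (cycle s)"
    using s(3,4) by (metis min.absorb1 take_stake)
  with s show "desert \<epsilon> n (take (M_par n) z)"
    unfolding desert_def s_desert_def by (intro exI[of _ s]) simp
qed

text \<open>The \<open>LEAST\<close> is attained: the middle of the first \<open>M_par n\<close>
  bits of a desert is deep.\<close>

lemma deep_in_desert_first_deep:
  assumes "has_desert \<epsilon> n x"
  shows "deep_in_desert \<epsilon> n x (first_deep \<epsilon> n x)"
proof -
  from assms obtain z ps ss where z: "desert \<epsilon> n z" "x = ps @ z @ ss"
    unfolding has_desert_def sublist_def by blast
  let ?i = "length ps + m_par n"
  have "subword x (?i - m_par n) (?i + m_par n) = take (M_par n) z"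
    using desert_take(1)[OF z(1)] by (simp add: subword_def M_par_def z(2) flip: mult_2)
  then have "deep_in_desert \<epsilon> n x ?i"
    using desert_take[OF z(1)] unfolding deep_in_desert_def by (simp add: M_par_def z(2))
  then show ?thesis
    unfolding first_deep_def by (rule LeastI)
qed

text \<open>The window starting at \<open>s\<close> is centred at \<open>s + m_par n\<close>, before
  the first deep location.\<close>

lemma not_desert_before_first_deep:
  assumes "has_desert \<epsilon> n x" "s < first_deep \<epsilon> n x - m_par n"
  shows "s + M_par n \<le> length x" "\<not> desert \<epsilon> n (subword x s (s + 2 * m_par n))"
proof -
  have "first_deep \<epsilon> n x + m_par n < length x"
    using deep_in_desert_first_deep[OF assms(1)] unfolding deep_in_desert_def by blast
  with assms(2) show le: "s + M_par n \<le> length x"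
    by (simp add: M_par_def)
  have "\<not> deep_in_desert \<epsilon> n x (s + m_par n)"
    using assms(2) unfolding first_deep_def by (intro not_less_Least) simp
  with le show "\<not> desert \<epsilon> n (subword x s (s + 2 * m_par n))"
    unfolding deep_in_desert_def by (simp add: M_par_def add_ac flip: mult_2)
qed


section \<open>Running time of the implementation\<close>

lemmas timed_defs = bind_timed_def return_timed_def cpu_def read_def write_def alloc_def

text \<open>Value and time are tracked in one induction; the \<open>1\<close> in
  \<open>c + 1\<close> pays for the loop control.\<close>

lemma loop_invariant:
  assumes "I 0 s"
    and "\<And>i s. i < k \<Longrightarrow> I i s \<Longrightarrow> I (Suc i) (val (f i s)) \<and> time (f i s) \<le> c"
  shows "I k (val (loop k f s)) \<and> time (loop k f s) \<le> k * (c + 1)"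
proof -
  have "I j (val (loop j f s)) \<and> time (loop j f s) \<le> j * (c + 1)" if "j \<le> k" for j
    using that
  proof (induction j)
    case (Suc j)
    then have "I j (val (loop j f s))" "time (loop j f s) \<le> j * (c + 1)"
      by auto
    with assms(2)[of j "val (loop j f s)"] Suc.prems show ?case
      by (auto simp: timed_defs)
  qed (simp add: assms(1) timed_defs)
  then show ?thesis
    by simp
qed

lemma pad_timed_correct:
  assumes "length z \<le> n"
  shows "val (pad_timed n z) = pad n z" "time (pad_timed n z) \<le> 5 * n + 2"
proof -
  define f where "f j u = bind_timed (cpu (j < length z)) (\<lambda>inside.
     if inside then bind_timed (read z j) (\<lambda>b. write u j b) else return_timed u)"
    for j and u :: "bool list"
  define I where "I i u \<longleftrightarrow> length u = n \<and> (\<forall>j<n. u ! j = (j < i \<and> j < length z \<and> z ! j))"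
    for i and u :: "bool list"
  have "I 0 (replicate n False)"
    by (simp add: I_def)
  moreover have "I (Suc i) (val (f i u)) \<and> time (f i u) \<le> 3" if "i < n" "I i u" for i u
    using that by (auto simp: f_def I_def timed_defs nth_list_update less_Suc_eq)
  ultimately have "I n (val (loop n f (replicate n False))) \<and>
      time (loop n f (replicate n False)) \<le> n * (3 + 1)"
    by (rule loop_invariant[where I = I])
  then have I: "I n (val (loop n f (replicate n False)))"
    and t: "time (loop n f (replicate n False)) \<le> n * (3 + 1)"
    by auto
  have pad_timed: "pad_timed n z = Timed (val (loop n f (replicate n False)))
      (n + 2 + time (loop n f (replicate n False)))"
    unfolding pad_timed_def f_def[abs_def] by (simp add: timed_defs)
  show "val (pad_timed n z) = pad n z"
    using I assms unfolding pad_timed I_def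
    by (intro nth_equalityI) (auto simp: pad_def nth_append)
  show "time (pad_timed n z) \<le> 5 * n + 2"
    using t unfolding pad_timed by simp
qed

lemma count_timed_correct:
  assumes "length cur = length us"
  shows "val (count_timed us cur) = count_list (map2 (!) us cur) True"
    and "time (count_timed us cur) \<le> 5 * length us + 1"
proof -
  define f where "f i ones = bind_timed (read us i) (\<lambda>u. bind_timed (read cur i) (\<lambda>j.
     bind_timed (read u j) (\<lambda>b. if b then cpu (ones + 1) else return_timed ones)))"
    for i and ones :: nat
  define I where "I i ones \<longleftrightarrow> ones = count_list (take i (map2 (!) us cur)) True" for i ones
  have "I 0 0"
    by (simp add: I_def)
  moreover have "I (Suc i) (val (f i ones)) \<and> time (f i ones) \<le> 4"
    if "i < length us" "I i ones" for i ones
    using that assms by (auto simp: f_def I_def timed_defs take_Suc_conv_app_nth)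
  ultimately have "I (length us) (val (loop (length us) f 0)) \<and>
      time (loop (length us) f 0) \<le> length us * (4 + 1)"
    by (rule loop_invariant[where I = I])
  then have I: "I (length us) (val (loop (length us) f 0))"
    and t: "time (loop (length us) f 0) \<le> length us * (4 + 1)"
    by auto
  have count_timed: "count_timed us cur = Timed (val (loop (length us) f 0))
      (1 + time (loop (length us) f 0))"
    unfolding count_timed_def f_def[abs_def] by (simp add: timed_defs)
  show "val (count_timed us cur) = count_list (map2 (!) us cur) True"
    using I assms by (simp add: count_timed I_def)
  show "time (count_timed us cur) \<le> 5 * length us + 1"
    using t by (simp add: count_timed)
qed

lemma advance_timed_correct:
  assumes "length cur = length us"
  shows "val (advance_timed us w cur) = map2 (\<lambda>u j. if u ! j = w then j + 1 else j) us cur"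
    and "time (advance_timed us w cur) \<le> 6 * length us + 1"
proof -
  define f where "f i cur = bind_timed (read us i) (\<lambda>u. bind_timed (read cur i) (\<lambda>j.
     bind_timed (read u j) (\<lambda>b. bind_timed (cpu (b = w)) (\<lambda>agree.
       if agree then write cur i (j + 1) else return_timed cur))))"
    for i and cur :: "nat list"
  \<comment> \<open>Here \<open>cur\<close> is the initial array: iteration \<open>i\<close> reads
    cell \<open>i\<close> before it is overwritten.\<close>
  define I where "I i c \<longleftrightarrow> length c = length us \<and>
      (\<forall>j<length us. c ! j = (if j < i \<and> us ! j ! (cur ! j) = w then cur ! j + 1 else cur ! j))"
    for i c
  have "I 0 cur"
    using assms by (simp add: I_def)
  moreover have "I (Suc i) (val (f i c)) \<and> time (f i c) \<le> 5"
    if "i < length us" "I i c" for i c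
    using that by (auto simp: f_def I_def timed_defs nth_list_update less_Suc_eq)
  ultimately have "I (length us) (val (loop (length us) f cur)) \<and>
      time (loop (length us) f cur) \<le> length us * (5 + 1)"
    by (rule loop_invariant[where I = I])
  then have I: "I (length us) (val (loop (length us) f cur))"
    and t: "time (loop (length us) f cur) \<le> length us * (5 + 1)"
    by auto
  have advance_timed: "advance_timed us w cur = Timed (val (loop (length us) f cur))
      (1 + time (loop (length us) f cur))"
    unfolding advance_timed_def f_def[abs_def] by (simp add: timed_defs)
  show "val (advance_timed us w cur) = map2 (\<lambda>u j. if u ! j = w then j + 1 else j) us cur"
    using I assms unfolding advance_timed I_def by (intro nth_equalityI) auto
  show "time (advance_timed us w cur) \<le> 6 * length us + 1"
    using t by (simp add: advance_timed)
qed

lemma length_currents: "length (currents us t) = length us"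
  by (induction t) (auto simp: Let_def)

lemma BMA_timed_correct:
  assumes "\<And>z. z \<in> set zs \<Longrightarrow> length z \<le> n"
  shows "val (BMA_timed n zs) = BMA n zs"
    and "time (BMA_timed n zs) \<le> 20 * (n + 1) * (length zs + 1)"
proof -
  let ?k = "length zs"
  define us where "us = map (pad n) zs"
  define g where "g i us = bind_timed (read zs i) (\<lambda>z. bind_timed (pad_timed n z) (\<lambda>u. write us i u))"
    for i and us :: "bool list list"
  define I where "I i vs \<longleftrightarrow> length vs = ?k \<and> (\<forall>j<?k. j < i \<longrightarrow> vs ! j = us ! j)"
    for i and vs :: "bool list list"
  have "I 0 (replicate ?k [])"
    by (simp add: I_def)
  moreover have "I (Suc i) (val (g i vs)) \<and> time (g i vs) \<le> 5 * n + 4"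
    if "i < ?k" "I i vs" for i vs
    using that pad_timed_correct[of "zs ! i" n] assms
    by (auto simp: g_def I_def timed_defs nth_list_update less_Suc_eq us_def)
  ultimately have "I ?k (val (loop ?k g (replicate ?k []))) \<and>
      time (loop ?k g (replicate ?k [])) \<le> ?k * (5 * n + 4 + 1)"
    by (rule loop_invariant[where I = I])
  then have I: "I ?k (val (loop ?k g (replicate ?k [])))"
    and time_g: "time (loop ?k g (replicate ?k [])) \<le> ?k * (5 * n + 4 + 1)"
    by auto
  from I have val_g: "val (loop ?k g (replicate ?k [])) = us"
    unfolding I_def by (intro nth_equalityI) (auto simp: us_def)

  define h where "h k vs = (\<lambda>t (cur, out). bind_timed (count_timed vs cur) (\<lambda>ones.
      bind_timed (cpu (k < 2 * ones)) (\<lambda>w. bind_timed (write out t w) (\<lambda>out'.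
      bind_timed (advance_timed vs w cur) (\<lambda>cur'. return_timed (cur', out'))))))"
    for k :: nat and vs
  define J where "J t s \<longleftrightarrow> fst s = currents us t \<and> length (snd s) = n \<and>
      (\<forall>j<n. j < t \<longrightarrow> snd s ! j = vote us (currents us j))" for t and s :: "nat list \<times> bool list"
  let ?s = "(replicate ?k 0, replicate n False)"
  have len: "length us = ?k"
    by (simp add: us_def)
  have "J 0 ?s"
    by (simp add: J_def us_def map_replicate_const)
  moreover have "J (Suc t) (val (h ?k us t s)) \<and> time (h ?k us t s) \<le> 11 * ?k + 4"
    if "t < n" "J t s" for t s
  proof -
    define out where "out = snd s"
    have s: "s = (currents us t, out)"
      using that by (simp add: prod_eq_iff J_def out_def)
    have out: "length out = n" "\<And>j. j < t \<Longrightarrow> out ! j = vote us (currents us j)"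
      using that by (auto simp: J_def out_def)
    have vote: "vote us (currents us t) \<longleftrightarrow> ?k < 2 * count_list (map2 (!) us (currents us t)) True"
      unfolding vote_def majority_def by (simp add: length_currents len)
    show ?thesis
      using count_timed_correct[of "currents us t" us] \<open>t < n\<close> out
        advance_timed_correct[of "currents us t" us "vote us (currents us t)"]
      by (auto simp: s h_def J_def timed_defs length_currents len vote[symmetric]
          nth_list_update less_Suc_eq Let_def)
  qed
  ultimately have "J n (val (loop n (h ?k us) ?s)) \<and>
      time (loop n (h ?k us) ?s) \<le> n * (11 * ?k + 4 + 1)"
    by (rule loop_invariant[where I = J])
  then have J: "J n (val (loop n (h ?k us) ?s))"
    and time_h: "time (loop n (h ?k us) ?s) \<le> n * (11 * ?k + 4 + 1)"
    by auto

  have "BMA_timed n zs = bind_timed (cpu ?k) (\<lambda>k. bind_timed (alloc k []) (\<lambda>us0.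
      bind_timed (loop k g us0) (\<lambda>us. bind_timed (alloc k 0) (\<lambda>cur0.
      bind_timed (alloc n False) (\<lambda>out0. bind_timed (loop n (h k us) (cur0, out0))
        (\<lambda>(cur, out). return_timed out))))))"
    unfolding BMA_timed_def g_def[abs_def] h_def[abs_def] ..
  then have BMA_timed: "BMA_timed n zs = Timed (snd (val (loop n (h ?k us) ?s)))
      (2 * ?k + n + 4 + time (loop ?k g (replicate ?k [])) + time (loop n (h ?k us) ?s))"
    by (simp add: bind_timed_def alloc_def return_timed_def cpu_def val_g split_beta)
  show "val (BMA_timed n zs) = BMA n zs"
    using J unfolding J_def BMA_timed BMA_def us_def[symmetric] Let_def
    by (intro nth_equalityI) auto
  have "time (BMA_timed n zs) \<le> 2 * ?k + n + 4 + ?k * (5 * n + 4 + 1) + n * (11 * ?k + 4 + 1)"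
    using time_g time_h unfolding BMA_timed by simp
  \<comment> \<open>The left side expands to
    \<open>16 * n * ?k + 6 * n + 7 * ?k + 4\<close>.\<close>
  also have "\<dots> \<le> 20 * (n + 1) * (?k + 1)"
    by (simp add: algebra_simps)
  finally show "time (BMA_timed n zs) \<le> 20 * (n + 1) * (?k + 1)" .
qed


section \<open>Probability of a wrong vote\<close>

abbreviation deletions :: "nat \<Rightarrow> real \<Rightarrow> (nat \<Rightarrow> bool) pmf" where
  "deletions n \<delta> \<equiv> Pi_pmf {..<n} False (\<lambda>_. bernoulli_pmf \<delta>)"

lemma prob_all_deleted:
  assumes "0 \<le> \<delta>" "\<delta> \<le> 1" "S \<subseteq> {..<n}"
  shows "measure_pmf.prob (deletions n \<delta>) {f. \<forall>i\<in>S. f i} = \<delta> ^ card S"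
proof -
  define B where "B i = (if i \<in> S then {True} else UNIV)" for i
  have "{f. \<forall>i\<in>S. f i} = Pi {..<n} B"
    using assms(3) by (auto simp: B_def Pi_def split: if_splits)
  then have "measure_pmf.prob (deletions n \<delta>) {f. \<forall>i\<in>S. f i} =
      (\<Prod>i<n. measure_pmf.prob (bernoulli_pmf \<delta>) (B i))"
    by (simp add: measure_Pi_pmf_Pi)
  also have "\<dots> = (\<Prod>i<n. if i \<in> S then \<delta> else 1)"
    using assms(1,2) by (intro prod.cong) (auto simp: B_def measure_pmf_single)
  also have "\<dots> = \<delta> ^ card S"
    using assms(3) by (simp add: prod.If_cases Int_absorb1)
  finally show ?thesis .
qed

text \<open>Union bound over the \<open>c\<close>-element subsets of \<open>I\<close> below
  \<open>n\<close>: there are at most \<open>W ^ c\<close> of them, each wholly deleted with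
  probability \<open>\<delta> ^ c\<close>.\<close>

lemma prob_many_deleted:
  assumes "0 \<le> \<delta>" "\<delta> \<le> 1" "finite I" "card I \<le> W"
  shows "measure_pmf.prob (deletions n \<delta>) {f. c \<le> card ({i. i < n \<and> f i} \<inter> I)} \<le> (real W * \<delta>) ^ c"
proof -
  let ?P = "measure_pmf.prob (deletions n \<delta>)"
  define J where "J = I \<inter> {..<n}"
  define F where "F = {S. S \<subseteq> J \<and> card S = c}"
  have fin: "finite J"
    by (simp add: J_def)
  have "card J \<le> W"
    using card_mono[OF assms(3), of J] assms(4) by (simp add: J_def)
  have "card F = card J choose c"
    using n_subsets[OF fin] by (simp add: F_def)
  also have "\<dots> \<le> W ^ c"
  proof (cases "c \<le> card J")
    case True
    then have "card J choose c \<le> card J ^ c"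
      by (rule binomial_le_pow)
    also have "\<dots> \<le> W ^ c"
      using \<open>card J \<le> W\<close> by (rule power_mono) simp
    finally show ?thesis .
  qed (simp add: binomial_eq_0)
  finally have card_F: "real (card F) \<le> real W ^ c"
    by (metis of_nat_le_iff of_nat_power)
  have "{f. c \<le> card ({i. i < n \<and> f i} \<inter> I)} \<subseteq> (\<Union>S\<in>F. {f. \<forall>i\<in>S. f i})"
  proof
    fix f assume "f \<in> {f. c \<le> card ({i. i < n \<and> f i} \<inter> I)}"
    then obtain S where "S \<subseteq> {i. i < n \<and> f i} \<inter> I" "card S = c"
      using obtain_subset_with_card_n[of c] by blast
    then show "f \<in> (\<Union>S\<in>F. {f. \<forall>i\<in>S. f i})"
      by (auto simp: F_def J_def)
  qed
  then have "?P {f. c \<le> card ({i. i < n \<and> f i} \<inter> I)} \<le> ?P (\<Union>S\<in>F. {f. \<forall>i\<in>S. f i})"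
    by (intro measure_pmf.finite_measure_mono) auto
  also have "\<dots> \<le> (\<Sum>S\<in>F. ?P {f. \<forall>i\<in>S. f i})"
    using fin by (intro measure_pmf.finite_measure_subadditive_finite) (auto simp: F_def)
  also have "\<dots> = (\<Sum>S\<in>F. \<delta> ^ c)"
    by (intro sum.cong refl, subst prob_all_deleted[OF assms(1,2)]) (auto simp: F_def J_def)
  also have "\<dots> \<le> (real W * \<delta>) ^ c"
    using card_F assms(1) by (simp add: power_mult_distrib mult_right_mono)
  finally show ?thesis .
qed

text \<open>The first term bounds the probability of a deletion among the latest
  \<open>(2 * C + 1) * M + 1\<close> positions, the second that of more than \<open>C\<close>
  deletions in some window of length \<open>(2 * C + 4) * M\<close>.\<close>

definition misvote_bound :: "nat \<Rightarrow> nat \<Rightarrow> nat \<Rightarrow> real \<Rightarrow> real" where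
  "misvote_bound n C M \<delta> =
     real ((2 * C + 1) * M + 1) * \<delta> + real n * (real ((2 * C + 4) * M) * \<delta>) ^ (C + 1)"

lemma prob_misvote_le:
  assumes "0 \<le> \<delta>" "\<delta> \<le> 1" "C \<le> M" "0 < M"
    and aperiodic: "\<And>s d. s < a \<Longrightarrow> 0 < d \<Longrightarrow> d \<le> C \<Longrightarrow>
      \<exists>j. j + d < M \<and> bit_at x (s + j) \<noteq> bit_at x (s + j + d)"
    and t: "t < a + M" "t < length x"
  shows "measure_pmf.prob (Del \<delta> x) {z. misvote x t z} \<le> misvote_bound (length x) C M \<delta>"
proof -
  let ?n = "length x"
  let ?P = "measure_pmf.prob (deletions ?n \<delta>)"
  define W where "W = (2 * C + 4) * M"
  define D where "D f = {i. i < ?n \<and> f i}" for f :: "nat \<Rightarrow> bool"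
  define J where "J = {t - (2 * C + 1) * M..t}"
  have D: "D f = {i. i < ?n \<and> f i}" for f
    by (simp add: D_def)
  have window: "(2 * C + 1) * M + C < W"
    using assms(3,4) by (simp add: W_def algebra_simps)
  \<comment> \<open>By \<open>front_eq_self\<close>, a wrong vote requires a recent deletion or a
    window with more than \<open>C\<close> deletions.\<close>
  have "{f. misvote x t (nths x {i. \<not> f i})} \<subseteq>
      {f. 1 \<le> card (D f \<inter> J)} \<union> (\<Union>s<?n. {f. C + 1 \<le> card (D f \<inter> {s..<s + W})})"
  proof (rule subsetI, rule ccontr)
    fix f
    assume f: "f \<in> {f. misvote x t (nths x {i. \<not> f i})}"
      and neg: "f \<notin> {f. 1 \<le> card (D f \<inter> J)} \<union> (\<Union>s<?n. {f. C + 1 \<le> card (D f \<inter> {s..<s + W})})"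
    interpret alignment "bit_at x" "D f"
      by unfold_locales (simp add: D_def)
    \<comment> \<open>All deletions lie below \<open>?n\<close>, so the union over \<open>?n\<close>
      window starts controls every window.\<close>
    have "card (D f \<inter> {s..<s + W}) \<le> C" for s
    proof (cases "s < ?n")
      case True
      with neg have "\<not> C + 1 \<le> card (D f \<inter> {s..<s + W})"
        by blast
      then show ?thesis
        by simp
    next
      case False
      then have "D f \<inter> {s..<s + W} = {}"
        by (auto simp: D_def)
      then show ?thesis
        by simp
    qed
    moreover have "D f \<inter> J = {}"
      using neg by (auto simp: J_def not_le)
    ultimately have "front t = t"
      using front_eq_self[OF aperiodic _ window t(1)] by (simp add: J_def)
    then have "\<not> misvote x t (nths x (- D f))"
      by (intro not_misvote t(2) refl)
    \<comment> \<open>The two sets differ only at indices past the end of \<open>x\<close>, which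
      \<open>nths\<close> ignores.\<close>
    moreover have "nths x (- D f) = nths x {i. \<not> f i}"
      unfolding nths_def D_def
      by (intro arg_cong[of _ _ "map fst"] filter_cong) (auto simp: set_zip)
    ultimately show False
      using f by simp
  qed
  then have "?P {f. misvote x t (nths x {i. \<not> f i})} \<le>
      ?P ({f. 1 \<le> card (D f \<inter> J)} \<union> (\<Union>s<?n. {f. C + 1 \<le> card (D f \<inter> {s..<s + W})}))"
    by (intro measure_pmf.finite_measure_mono) auto
  also have "\<dots> \<le> ?P {f. 1 \<le> card (D f \<inter> J)} +
      ?P (\<Union>s<?n. {f. C + 1 \<le> card (D f \<inter> {s..<s + W})})"
    by (intro measure_Un_le) auto
  also have "\<dots> \<le> ?P {f. 1 \<le> card (D f \<inter> J)} +
      (\<Sum>s<?n. ?P {f. C + 1 \<le> card (D f \<inter> {s..<s + W})})"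
    by (intro add_left_mono measure_pmf.finite_measure_subadditive_finite) auto
  also have "\<dots> \<le> (real ((2 * C + 1) * M + 1) * \<delta>) ^ 1 + (\<Sum>s<?n. (real W * \<delta>) ^ (C + 1))"
    unfolding D
    by (intro add_mono sum_mono prob_many_deleted assms(1,2)) (auto simp: J_def)
  also have "\<dots> = misvote_bound ?n C M \<delta>"
    by (simp add: misvote_bound_def W_def)
  finally show ?thesis
    by (simp add: Del_def vimage_def)
qed


section \<open>Amplification by majority votes\<close>

lemma replicate_pmf_Suc_pair:
  "replicate_pmf (Suc N) p = map_pmf (\<lambda>(z, zs). z # zs) (pair_pmf p (replicate_pmf N p))"
  by (simp add: pair_pmf_def map_bind_pmf)

text \<open>In effect a union bound over at most \<open>2 ^ N\<close> sets of \<open>k\<close> bad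
  traces, each of probability at most \<open>1 / 16 ^ k\<close>. The induction splits on the first
  trace: it is bad and so are \<open>k - 1\<close> others, or \<open>k\<close> others are
  bad.\<close>

lemma prob_filter_length_ge:
  fixes p :: "'a :: countable pmf"
  assumes "measure_pmf.prob p {z. B z} \<le> 1 / 16"
  shows "measure_pmf.prob (replicate_pmf N p) {zs. k \<le> length (filter B zs)} \<le> 2 ^ N / 16 ^ k"
proof (induction N arbitrary: k)
  case 0
  then show ?case
    by (cases k) (auto simp: indicator_def)
next
  case (Suc N)
  let ?Q = "replicate_pmf N p"
  show ?case
  proof (cases k)
    case 0
    have "measure_pmf.prob (replicate_pmf (Suc N) p) {zs. k \<le> length (filter B zs)} \<le> 1"
      by simp
    also have "\<dots> \<le> 2 ^ Suc N / 16 ^ k"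
      using one_le_power[of "2::real" "Suc N"] by (simp add: 0)
    finally show ?thesis .
  next
    case (Suc j)
    let ?A = "{z. B z} \<times> {zs. j \<le> length (filter B zs)}"
    let ?A' = "UNIV \<times> {zs. k \<le> length (filter B zs)}"
    have "measure_pmf.prob (replicate_pmf (Suc N) p) {zs. k \<le> length (filter B zs)} =
        measure_pmf.prob (pair_pmf p ?Q) ((\<lambda>(z, zs). z # zs) -` {zs. k \<le> length (filter B zs)})"
      unfolding replicate_pmf_Suc_pair by simp
    also have "\<dots> \<le> measure_pmf.prob (pair_pmf p ?Q) (?A \<union> ?A')"
      by (intro measure_pmf.finite_measure_mono) (auto simp: Suc split: if_splits)
    also have "\<dots> \<le> measure_pmf.prob (pair_pmf p ?Q) ?A + measure_pmf.prob (pair_pmf p ?Q) ?A'"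
      by (intro measure_Un_le) auto
    also have "\<dots> = measure_pmf.prob p {z. B z} * measure_pmf.prob ?Q {zs. j \<le> length (filter B zs)} +
        measure_pmf.prob ?Q {zs. k \<le> length (filter B zs)}"
      by (simp add: measure_pmf_prob_product)
    also have "\<dots> \<le> 1 / 16 * (2 ^ N / 16 ^ j) + 2 ^ N / 16 ^ k"
      using Suc.IH assms by (intro add_mono mult_mono) auto
    also have "\<dots> = 2 ^ Suc N / 16 ^ k"
      by (simp add: Suc field_simps)
    finally show ?thesis .
  qed
qed

text \<open>If at least half are bad, then at least \<open>k\<close> are, where
  \<open>2 * k \<ge> N\<close>; so \<open>16 ^ k \<ge> 4 ^ N\<close> outweighs
  \<open>2 ^ N\<close>.\<close>

lemma prob_majority_filter:
  fixes p :: "'a :: countable pmf"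
  assumes "measure_pmf.prob p {z. B z} \<le> 1 / 16"
  shows "measure_pmf.prob (replicate_pmf N p) {zs. N \<le> 2 * length (filter B zs)} \<le> 1 / 2 ^ N"
proof -
  define k where "k = (N + 1) div 2"
  have "measure_pmf.prob (replicate_pmf N p) {zs. N \<le> 2 * length (filter B zs)} \<le>
      measure_pmf.prob (replicate_pmf N p) {zs. k \<le> length (filter B zs)}"
    by (intro measure_pmf.finite_measure_mono) (auto simp: k_def)
  also have "\<dots> \<le> 2 ^ N / 16 ^ k"
    by (rule prob_filter_length_ge[OF assms])
  also have "\<dots> \<le> 2 ^ N / 4 ^ N"
  proof (intro divide_left_mono)
    have "(4::real) ^ N \<le> 4 ^ (2 * k)"
      by (intro power_increasing) (auto simp: k_def)
    then show "(4::real) ^ N \<le> 16 ^ k"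
      by (simp add: power_mult)
  qed auto
  also have "\<dots> = 1 / (2::real) ^ N"
    by (simp flip: power_divide add: power_one_over[symmetric])
  finally show ?thesis .
qed

lemma prob_BMA_prefix:
  assumes "\<And>t. t < L \<Longrightarrow> measure_pmf.prob p {z. misvote x t z} \<le> 1 / 16" "L \<le> length x"
  shows "measure_pmf.prob (replicate_pmf N p) {zs. take L (BMA (length x) zs) = take L x}
    \<ge> 1 - real (length x) / 2 ^ N"
proof -
  let ?Q = "measure_pmf.prob (replicate_pmf N p)"
  let ?E = "{zs. take L (BMA (length x) zs) = take L x}"
  \<comment> \<open>Restricting to the support gives \<open>length zs = N\<close>, which turns a
    lost majority into a count against \<open>N\<close>.\<close>
  have "?Q (- ?E) = ?Q (- ?E \<inter> set_pmf (replicate_pmf N p))"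
    by (simp add: measure_Int_set_pmf)
  also have "\<dots> \<le> ?Q (\<Union>t<L. {zs. N \<le> 2 * length (filter (misvote x t) zs)})"
  proof (intro measure_pmf.finite_measure_mono subsetI)
    fix zs assume zs: "zs \<in> - ?E \<inter> set_pmf (replicate_pmf N p)"
    then have "length zs = N"
      by (simp add: set_replicate_pmf)
    with zs BMA_take_eq[OF assms(2), of zs]
    show "zs \<in> (\<Union>t<L. {zs. N \<le> 2 * length (filter (misvote x t) zs)})"
      by (auto simp: not_less[symmetric])
  qed auto
  also have "\<dots> \<le> (\<Sum>t<L. ?Q {zs. N \<le> 2 * length (filter (misvote x t) zs)})"
    by (intro measure_pmf.finite_measure_subadditive_finite) auto
  also have "\<dots> \<le> (\<Sum>t<L. 1 / 2 ^ N)"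
    using assms(1) by (intro sum_mono prob_majority_filter) auto
  also have "\<dots> \<le> real (length x) / 2 ^ N"
    using assms(2) by (simp add: divide_right_mono)
  finally show ?thesis
    using measure_pmf.prob_compl[of ?E "replicate_pmf N p"] by (simp add: Compl_eq_Diff_UNIV)
qed


section \<open>Asymptotics\<close>

lemma M_par_le:
  assumes "n \<ge> 1"
  shows "real (M_par n) \<le> 3 * real n powr (1 / 3)"
proof -
  have "real (m_par n) \<le> root 3 (real n)"
    by (simp add: m_par_def of_nat_nat)
  moreover have "root 3 (real n) = real n powr (1 / 3)"
    using assms by (simp add: root_powr_inverse)
  moreover have "1 \<le> real n powr (1 / 3)"
    using assms by (simp add: ge_one_powr_ge_zero)
  ultimately show ?thesis
    by (simp add: M_par_def)
qed

lemma filterlim_M_par: "filterlim M_par at_top sequentially"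
proof (rule filterlim_at_top_mono)
  show "filterlim (\<lambda>n. nat \<lfloor>root 3 (real n)\<rfloor>) at_top sequentially"
    by real_asymp
  show "\<forall>\<^sub>F n in sequentially. nat \<lfloor>root 3 (real n)\<rfloor> \<le> M_par n"
    by (intro always_eventually) (simp add: M_par_def m_par_def)
qed

text \<open>Since \<open>M * \<delta> \<le> 3 * n powr (- \<epsilon>)\<close>, the second term is of
  order \<open>n powr (1 - \<epsilon> * (C + 1))\<close>, which
  \<open>\<epsilon> * C \<ge> 100\<close> brings below \<open>n powr (- 1)\<close>.\<close>

lemma misvote_bound_le:
  assumes "n \<ge> 1" "\<epsilon> > 0"
  defines "C \<equiv> C_par \<epsilon>"
  shows "misvote_bound n C (M_par n) (real n powr (- (1 / 3 + \<epsilon>))) \<le>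
    (6 * real C + 6) * real n powr (- \<epsilon>) + (6 * real C + 12) ^ (C + 1) * real n powr (- 1)"
proof -
  define M where "M = M_par n"
  define \<delta> where "\<delta> = real n powr (- (1 / 3 + \<epsilon>))"
  have n: "real n > 0"
    using assms(1) by simp
  have "M \<ge> 1"
    by (simp add: M_def M_par_def)
  have "real M * \<delta> \<le> 3 * real n powr (1 / 3) * \<delta>"
    using M_par_le[OF assms(1)] by (intro mult_right_mono) (simp_all add: M_def \<delta>_def)
  also have "\<dots> = 3 * real n powr (- \<epsilon>)"
    using n by (simp add: \<delta>_def flip: powr_add)
  finally have M\<delta>: "real M * \<delta> \<le> 3 * real n powr (- \<epsilon>)" .
  have "real ((2 * C + 1) * M + 1) * \<delta> \<le> real ((2 * C + 2) * M) * \<delta>"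
    using \<open>M \<ge> 1\<close> by (intro mult_right_mono) (simp_all add: algebra_simps \<delta>_def flip: of_nat_mult)
  also have "\<dots> = (2 * real C + 2) * (real M * \<delta>)"
    by (simp add: algebra_simps)
  also have "\<dots> \<le> (2 * real C + 2) * (3 * real n powr (- \<epsilon>))"
    using M\<delta> by (intro mult_left_mono) simp_all
  finally have 1: "real ((2 * C + 1) * M + 1) * \<delta> \<le> (6 * real C + 6) * real n powr (- \<epsilon>)"
    by (simp add: algebra_simps)
  have "real ((2 * C + 4) * M) * \<delta> = (2 * real C + 4) * (real M * \<delta>)"
    by (simp add: algebra_simps)
  also have "\<dots> \<le> (2 * real C + 4) * (3 * real n powr (- \<epsilon>))"
    using M\<delta> by (intro mult_left_mono) simp_all
  finally have "(real ((2 * C + 4) * M) * \<delta>) ^ (C + 1) \<le>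
      ((6 * real C + 12) * real n powr (- \<epsilon>)) ^ (C + 1)"
    by (intro power_mono) (simp_all add: algebra_simps \<delta>_def)
  then have "real n * (real ((2 * C + 4) * M) * \<delta>) ^ (C + 1) \<le>
      (6 * real C + 12) ^ (C + 1) * (real n * (real n powr (- \<epsilon>)) ^ (C + 1))"
    using n by (simp add: power_mult_distrib mult_ac mult_left_mono)
  also have "real n * (real n powr (- \<epsilon>)) ^ (C + 1) = real n powr (1 - \<epsilon> * real (C + 1))"
    using n by (simp add: powr_power powr_diff powr_minus powr_add field_simps)
  also have "\<dots> \<le> real n powr (- 1)"
  proof (intro powr_mono)
    have "100 / \<epsilon> \<le> real C"
      unfolding C_def C_par_def by linarith
    then have "100 \<le> \<epsilon> * real C"
      using assms(2) by (simp add: field_simps)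
    then show "1 - \<epsilon> * real (C + 1) \<le> - 1"
      using assms(2) by (simp add: algebra_simps)
  qed (use assms(1) in simp)
  finally have "real n * (real ((2 * C + 4) * M) * \<delta>) ^ (C + 1) \<le>
      (6 * real C + 12) ^ (C + 1) * real n powr (- 1)"
    by (simp add: mult_left_mono)
  with 1 show ?thesis
    unfolding misvote_bound_def M_def \<delta>_def by linarith
qed

lemma eventually_misvote_bound_le:
  assumes "\<epsilon> > 0"
  shows "\<forall>\<^sub>F n in sequentially.
    misvote_bound n (C_par \<epsilon>) (M_par n) (real n powr (- (1 / 3 + \<epsilon>))) \<le> 1 / 16"
proof -
  define A where "A = 6 * real (C_par \<epsilon>) + 6"
  define B where "B = (6 * real (C_par \<epsilon>) + 12) ^ (C_par \<epsilon> + 1)"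
  have "(\<lambda>n. real n powr (- \<epsilon>)) \<longlonglongrightarrow> 0" "(\<lambda>n. real n powr (- 1)) \<longlonglongrightarrow> 0"
    using assms by real_asymp+
  then have "(\<lambda>n. A * real n powr (- \<epsilon>) + B * real n powr (- 1)) \<longlonglongrightarrow> A * 0 + B * 0"
    by (intro tendsto_intros)
  then have "(\<lambda>n. A * real n powr (- \<epsilon>) + B * real n powr (- 1)) \<longlonglongrightarrow> 0"
    by simp
  then have "\<forall>\<^sub>F n in sequentially. A * real n powr (- \<epsilon>) + B * real n powr (- 1) < 1 / 16"
    by (rule order_tendstoD) simp
  then show ?thesis
    using eventually_ge_at_top[of 1]
  proof eventually_elim
    case (elim n)
    then show ?case
      using misvote_bound_le[OF elim(2) assms] by (simp add: A_def B_def)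
  qed
qed

text \<open>As \<open>ln 2 \<ge> 2 / 3\<close> and \<open>5 * 2 / 3 \<ge> 3\<close>, the hypothesis
  gives \<open>2 ^ N \<ge> n ^ 3\<close>; one factor \<open>n\<close> pays for the union over all
  times.\<close>

lemma failure_prob_le:
  assumes "n \<ge> 1" "5 * ln (real n) \<le> real N"
  shows "real n / 2 ^ N \<le> 1 / (real n)\<^sup>2"
proof -
  have "3 * ln (real n) \<le> (2 / 3) * (5 * ln (real n))"
    using assms(1) by simp
  also have "\<dots> \<le> ln 2 * real N"
    using assms ln2_ge_two_thirds by (intro mult_mono) auto
  finally have "ln (real n ^ 3) \<le> ln (2 ^ N)"
    using assms(1) by (simp add: ln_realpow mult.commute)
  then have "real n ^ 3 \<le> 2 ^ N"
    using assms(1) by (subst (asm) ln_le_cancel_iff) auto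
  then show ?thesis
    using assms(1) by (simp add: field_simps power2_eq_square power3_eq_cube)
qed

text \<open>Serves both claims: windows starting before \<open>a\<close> are no deserts, and
  recovery extends \<open>M_par n\<close> bits past \<open>a\<close>.\<close>

lemma BMA_recovers_before_desert:
  assumes "\<epsilon> > 0" "length x = n" "n \<ge> 1" "C_par \<epsilon> \<le> M_par n"
    and "misvote_bound n (C_par \<epsilon>) (M_par n) (real n powr (- (1 / 3 + \<epsilon>))) \<le> 1 / 16"
    and "5 * ln (real n) \<le> real N"
    and "\<And>s. s < a \<Longrightarrow> s + M_par n \<le> n \<and> \<not> desert \<epsilon> n (subword x s (s + 2 * m_par n))"
    and "L \<le> a + M_par n" "L \<le> n"
  shows "measure_pmf.prob (replicate_pmf N (Del (real n powr (- (1 / 3 + \<epsilon>))) x))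
    {zs. take L (BMA n zs) = take L x} \<ge> 1 - 1 / (real n)\<^sup>2"
proof -
  let ?\<delta> = "real n powr (- (1 / 3 + \<epsilon>))"
  have "?\<delta> \<le> real n powr 0"
    using assms(1,3) by (intro powr_mono) auto
  then have \<delta>: "0 \<le> ?\<delta>" "?\<delta> \<le> 1"
    using assms(3) by auto
  have "measure_pmf.prob (Del ?\<delta> x) {z. misvote x t z} \<le> 1 / 16" if "t < L" for t
  proof -
    have "measure_pmf.prob (Del ?\<delta> x) {z. misvote x t z} \<le>
        misvote_bound (length x) (C_par \<epsilon>) (M_par n) ?\<delta>"
    proof (rule prob_misvote_le[OF \<delta> assms(4), where a = a])
      show "\<exists>j. j + d < M_par n \<and> bit_at x (s + j) \<noteq> bit_at x (s + j + d)"
        if "s < a" "0 < d" "d \<le> C_par \<epsilon>" for s d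
        using assms(2,4) assms(7)[OF that(1)] that(2,3)
        by (intro aperiodic_of_not_desert) auto
    qed (use assms that in \<open>auto simp: M_par_def\<close>)
    with assms(2,5) show ?thesis
      by simp
  qed
  then have "1 - real n / 2 ^ N \<le> measure_pmf.prob (replicate_pmf N (Del ?\<delta> x))
      {zs. take L (BMA n zs) = take L x}"
    using prob_BMA_prefix[of L "Del ?\<delta> x" x N] assms(2,9) by simp
  with failure_prob_le[OF assms(3,6)] show ?thesis
    by linarith
qed

theorem theorem3:
  fixes \<epsilon> :: real
  assumes "\<epsilon> > 0"
  shows "\<exists>K > 0. \<forall>N :: nat \<Rightarrow> nat.
    (\<lambda>n. real (N n)) \<in> O(\<lambda>n. ln (real n)) \<and>
    (\<forall>\<^sub>F n in sequentially. K * ln (real n) \<le> real (N n)) \<longrightarrow>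
    (\<exists>(T :: nat \<Rightarrow> real) (k :: nat).
       T \<in> O(\<lambda>n. real n * ln (real n) ^ k) \<and>
       (\<forall>n zs. length zs = N n \<and> (\<forall>z \<in> set zs. length z \<le> n) \<longrightarrow>
          val (BMA_timed n zs) = BMA n zs \<and>
          length (BMA n zs) = n \<and>
          real (time (BMA_timed n zs)) \<le> T n)) \<and>
    (\<forall>\<^sub>F n in sequentially. \<forall>x :: bool list. length x = n \<longrightarrow>
       (let \<delta> = real n powr (- (1 / 3 + \<epsilon>));
            traces = replicate_pmf (N n) (Del \<delta> x);
            m = m_par n;
            r = first_deep \<epsilon> n x
        in
          (\<not> has_desert \<epsilon> n x \<longrightarrow>
             measure_pmf.prob traces {zs. BMA n zs = x} \<ge> 1 - 1 / (real n)\<^sup>2) \<and>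
          (has_desert \<epsilon> n x \<longrightarrow>
             measure_pmf.prob traces {zs. take (r + m + 1) (BMA n zs) = take (r + m + 1) x}
               \<ge> 1 - 1 / (real n)\<^sup>2)))"
\<comment> \<open>The constant 5 is the one that \<open>failure_prob_le\<close> asks for.\<close>
proof (intro exI[of _ "5 :: real"] conjI allI impI)
  show "(5 :: real) > 0"
    by simp
next
  fix N :: "nat \<Rightarrow> nat"
  assume N: "(\<lambda>n. real (N n)) \<in> O(\<lambda>n. ln (real n)) \<and>
    (\<forall>\<^sub>F n in sequentially. 5 * ln (real n) \<le> real (N n))"
  define T where "T n = 20 * (real n + 1) * (real (N n) + 1)" for n
  have "(\<lambda>n. 20 * (real n + 1)) \<in> O(\<lambda>n. real n)"
    by real_asymp
  moreover have "(\<lambda>_. 1) \<in> O(\<lambda>n. ln (real n))"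
    by real_asymp
  then have "(\<lambda>n. real (N n) + 1) \<in> O(\<lambda>n. ln (real n))"
    using N by (intro sum_in_bigo) auto
  ultimately have "T \<in> O(\<lambda>n. real n * ln (real n) ^ 1)"
    unfolding T_def power_one_right by (rule landau_o.big.mult)
  moreover have "val (BMA_timed n zs) = BMA n zs \<and> length (BMA n zs) = n \<and>
      real (time (BMA_timed n zs)) \<le> T n"
    if "length zs = N n \<and> (\<forall>z \<in> set zs. length z \<le> n)" for n zs
  proof -
    have "real (time (BMA_timed n zs)) \<le> real (20 * (n + 1) * (length zs + 1))"
      using BMA_timed_correct(2)[of zs n] that by (intro of_nat_mono) auto
    then show ?thesis
      using BMA_timed_correct(1)[of zs n] that by (simp add: T_def length_BMA algebra_simps)
  qed
  ultimately show "\<exists>(T :: nat \<Rightarrow> real) (k :: nat).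
       T \<in> O(\<lambda>n. real n * ln (real n) ^ k) \<and>
       (\<forall>n zs. length zs = N n \<and> (\<forall>z \<in> set zs. length z \<le> n) \<longrightarrow>
          val (BMA_timed n zs) = BMA n zs \<and>
          length (BMA n zs) = n \<and>
          real (time (BMA_timed n zs)) \<le> T n)"
    by blast
next
  fix N :: "nat \<Rightarrow> nat"
  assume N: "(\<lambda>n. real (N n)) \<in> O(\<lambda>n. ln (real n)) \<and>
    (\<forall>\<^sub>F n in sequentially. 5 * ln (real n) \<le> real (N n))"
  have "\<forall>\<^sub>F n in sequentially. C_par \<epsilon> \<le> M_par n"
    using filterlim_M_par by (simp add: filterlim_at_top)
  moreover note eventually_misvote_bound_le[OF assms] conjunct2[OF N] eventually_ge_at_top[of 1]
  ultimately show "\<forall>\<^sub>F n in sequentially. \<forall>x :: bool list. length x = n \<longrightarrow>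
       (let \<delta> = real n powr (- (1 / 3 + \<epsilon>));
            traces = replicate_pmf (N n) (Del \<delta> x);
            m = m_par n;
            r = first_deep \<epsilon> n x
        in
          (\<not> has_desert \<epsilon> n x \<longrightarrow>
             measure_pmf.prob traces {zs. BMA n zs = x} \<ge> 1 - 1 / (real n)\<^sup>2) \<and>
          (has_desert \<epsilon> n x \<longrightarrow>
             measure_pmf.prob traces {zs. take (r + m + 1) (BMA n zs) = take (r + m + 1) x}
               \<ge> 1 - 1 / (real n)\<^sup>2))"
  proof eventually_elim
    case (elim n)
    show ?case
      unfolding Let_def
    proof (intro allI impI conjI)
      fix x :: "bool list"
      assume x: "length x = n" and no_desert: "\<not> has_desert \<epsilon> n x"
      have "measure_pmf.prob (replicate_pmf (N n) (Del (real n powr (- (1 / 3 + \<epsilon>))) x))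
          {zs. take n (BMA n zs) = take n x} \<ge> 1 - 1 / (real n)\<^sup>2"
        \<comment> \<open>This \<open>a\<close> counts the windows of length \<open>M_par n\<close>
          in \<open>x\<close>; \<open>a + M_par n \<ge> n\<close> holds even if \<open>x\<close> is
          too short to contain one.\<close>
        by (rule BMA_recovers_before_desert[OF assms x elim(4,1,2,3), where a = "n + 1 - M_par n"])
          (use no_desert sublist_subword in \<open>auto simp: has_desert_def\<close>)
      then show "measure_pmf.prob (replicate_pmf (N n) (Del (real n powr (- (1 / 3 + \<epsilon>))) x))
          {zs. BMA n zs = x} \<ge> 1 - 1 / (real n)\<^sup>2"
        using x by (simp add: length_BMA)
    next
      fix x :: "bool list"
      assume x: "length x = n" and "has_desert \<epsilon> n x"
      let ?r = "first_deep \<epsilon> n x"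
      have r: "m_par n \<le> ?r" "?r + m_par n < n"
        using deep_in_desert_first_deep[OF \<open>has_desert \<epsilon> n x\<close>] x
        unfolding deep_in_desert_def by auto
      show "measure_pmf.prob (replicate_pmf (N n) (Del (real n powr (- (1 / 3 + \<epsilon>))) x))
          {zs. take (?r + m_par n + 1) (BMA n zs) = take (?r + m_par n + 1) x} \<ge> 1 - 1 / (real n)\<^sup>2"
        \<comment> \<open>Windows starting before this \<open>a\<close> are centred before
          \<open>?r\<close>, and \<open>a + M_par n\<close> is exactly
          \<open>?r + m_par n + 1\<close>.\<close>
        by (rule BMA_recovers_before_desert[OF assms x elim(4,1,2,3), where a = "?r - m_par n"])
          (use r not_desert_before_first_deep[OF \<open>has_desert \<epsilon> n x\<close>] x in \<open>auto simp: M_par_def\<close>)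
    qed
  qed
qed

end
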